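(* Let $B\in\mathbb{Q}^{n\times m}$ have rank $n$ ($m\ge n$), let $P,R_w\in\mathbb{R}^{n\times n}$ be symmetric positive definite, let $H\in\mathbb{R}^{m\times n}$ satisfy $BH=I$, and let $k\in\mathbb{R}$. Consider the system $\dot x(t)=Bu(t)-w(t)$ subject only to the ellipsoidal constraint $w(t)\in\mathcal W=\{w\in\mathbb{R}^n: w^TR_ww\le 1\}$ on $w$ (no constraint on $u$), controlled via the linear state feedback $u=-kHx$. Let $V(x)=x^TPx$. Then for every $x\in\mathbb{R}^n$ the condition $\dot V<0$ holds at $x$ (for all $w\in\mathcal W$) if and only if $$k^2(x^TPx)^2-x^TPR_w^{-1}Px>0.$$
   Context: $\dot V$ denotes the derivative of $V$ along the closed-loop dynamics $\dot x=-kBHx-w=-kx-w$, i.e. at state $x$ with demand $w$, $\dot V=2x^TP(-kx-w)$. The condition "$\dot V<0$ at $x$" means $2x^TP(-kx-w)<0$ for every $w\in\mathcal W$.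
   Formalization: The gain k is assumed nonnegative: for every k < 0 the equivalence fails at large x (e.g. n = m = 1, B = H = P = R_w = 1, k = -2, x = 1: the inequality reads 3 > 0, but w = 0 gives a derivative of 4 > 0). *)

theory Defs
  imports "HOL-Analysis.Analysis"
begin

definition sym_pos_def :: "real^'n^'n \<Rightarrow> bool" where
  "sym_pos_def A \<longleftrightarrow> transpose A = A \<and> (\<forall>x. x \<noteq> 0 \<longrightarrow> 0 < x \<bullet> (A *v x))"

definition ellipsoid :: "real^'n^'n \<Rightarrow> (real^'n) set" where
  "ellipsoid R = {w. w \<bullet> (R *v w) \<le> 1}"

definition system_rhs :: "real^'m^'n \<Rightarrow> real^'m \<Rightarrow> real^'n \<Rightarrow> real^'n" where
  "system_rhs B u w = B *v u - w"

definition linear_feedback :: "real \<Rightarrow> real^'n^'m \<Rightarrow> real^'n \<Rightarrow> real^'m" where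
  "linear_feedback k H x = - (k *\<^sub>R (H *v x))"

definition closed_loop :: "real^'m^'n \<Rightarrow> real^'n^'m \<Rightarrow> real \<Rightarrow> real^'n \<Rightarrow> real^'n \<Rightarrow> real^'n" where
  "closed_loop B H k x w = system_rhs B (linear_feedback k H x) w"

definition quadratic_fun :: "real^'n^'n \<Rightarrow> real^'n \<Rightarrow> real" where
  "quadratic_fun P x = x \<bullet> (P *v x)"

text \<open>Derivative of \<open>V\<close> at \<open>x\<close> in the direction \<open>v\<close>; along a solution of \<open>x' = f x\<close>,
  the time derivative of \<open>V\<close> is the value at \<open>v = f x\<close>.\<close>

definition deriv_along :: "(real^'n \<Rightarrow> real) \<Rightarrow> real^'n \<Rightarrow> real^'n \<Rightarrow> real" where
  "deriv_along V x v = frechet_derivative V (at x) v"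

end

theory Submission
  imports Defs
begin

text \<open>Writing \<open>y = P x\<close>, the derivative is \<open>- 2 (k x \<bullet> y + y \<bullet> w)\<close>. By the Cauchy--Schwarz
  inequality for the inner product defined by \<open>R\<^sub>w\<close>, the maximum of \<open>- y \<bullet> w\<close> over the ellipsoid is
  \<open>sqrt (y \<bullet> R\<^sub>w\<^sup>-\<^sup>1 y)\<close>, so the condition says that this root is less than \<open>k x \<bullet> P x\<close>.
  As \<open>k \<ge> 0\<close>, both sides are nonnegative and can be squared.\<close>

lemma inner_symmetric_matrix:
  fixes A :: "real^'n^'n"
  assumes "transpose A = A"
  shows "x \<bullet> (A *v y) = (A *v x) \<bullet> y"
  using dot_lmul_matrix[of x A y] assms by (metis transpose_matrix_vector)

lemma sym_pos_def_nonneg: "sym_pos_def A \<Longrightarrow> 0 \<le> x \<bullet> (A *v x)"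
  unfolding sym_pos_def_def by (cases "x = 0") (auto simp: less_imp_le)

lemma sym_pos_def_invertible:
  fixes A :: "real^'n^'n"
  assumes "sym_pos_def A"
  shows "invertible A"
proof -
  have "x = 0" if "A *v x = 0" for x
    using assms that unfolding sym_pos_def_def by (metis inner_zero_right less_irrefl)
  then show ?thesis
    unfolding invertible_left_inverse matrix_left_invertible_ker by blast
qed

lemma matrix_inv_right:
  "invertible A \<Longrightarrow> A ** matrix_inv A = mat 1"
  unfolding invertible_def matrix_inv_def by (rule someI2_ex) auto

lemma sym_pos_def_Cauchy_Schwarz:
  fixes A :: "real^'n^'n"
  assumes A: "sym_pos_def A"
  shows "(z \<bullet> (A *v w))\<^sup>2 \<le> (z \<bullet> (A *v z)) * (w \<bullet> (A *v w))"
proof (cases "z = 0")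
  case False
  define a b c where "a = z \<bullet> (A *v z)" and "b = z \<bullet> (A *v w)" and "c = w \<bullet> (A *v w)"
  have "0 < a"
    using A False by (simp add: a_def sym_pos_def_def)
  have sym: "w \<bullet> (A *v z) = b"
    using A inner_symmetric_matrix[of A w z] by (simp add: b_def sym_pos_def_def inner_commute)
  \<comment> \<open>This vector is \<open>a\<close> times the component of \<open>w\<close>
    orthogonal to \<open>z\<close> for the form of \<open>A\<close>. Scaling by \<open>a\<close>
    avoids the quotient \<open>b / a\<close>.\<close>
  have "0 \<le> (a *\<^sub>R w - b *\<^sub>R z) \<bullet> (A *v (a *\<^sub>R w - b *\<^sub>R z))"
    by (rule sym_pos_def_nonneg[OF A])
  also have "\<dots> = a * (a * c) - a * (b * b) - b * (a * b) + b * (b * a)"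
    by (simp add: matrix_vector_mult_diff_distrib matrix_vector_mult_scaleR inner_diff_left
        inner_diff_right sym flip: a_def b_def c_def) (simp add: algebra_simps)
  also have "\<dots> = a * (a * c - b\<^sup>2)"
    by (simp add: algebra_simps power2_eq_square)
  finally show ?thesis
    using \<open>0 < a\<close> by (simp add: zero_le_mult_iff a_def b_def c_def)
qed simp

text \<open>The product rule gives two terms, which coincide by the symmetry of
  \<open>P\<close>.\<close>

lemma deriv_along_quadratic_fun:
  fixes P :: "real^'n^'n"
  assumes "transpose P = P"
  shows "deriv_along (quadratic_fun P) x v = 2 * ((P *v x) \<bullet> v)"
proof -
  have P: "bounded_linear ((*v) P)"
    by (simp add: linear_conv_bounded_linear)
  have "(quadratic_fun P has_derivative (\<lambda>v. x \<bullet> (P *v v) + v \<bullet> (P *v x))) (at x)"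
    unfolding quadratic_fun_def
    by (intro has_derivative_inner has_derivative_ident bounded_linear.has_derivative[OF P])
  then have "deriv_along (quadratic_fun P) x v = x \<bullet> (P *v v) + v \<bullet> (P *v x)"
    unfolding deriv_along_def by (simp flip: frechet_derivative_at)
  then show ?thesis
    using inner_symmetric_matrix[OF assms, of x v] by (simp add: inner_commute)
qed

lemma closed_loop_right_inverse:
  assumes "B ** H = mat 1"
  shows "closed_loop B H k x w = - (k *\<^sub>R x) - w"
proof -
  have "B *v (- (k *\<^sub>R (H *v x))) = - k *\<^sub>R ((B ** H) *v x)"
    by (simp flip: scaleR_minus_left
        add: matrix_vector_mult_scaleR matrix_vector_mul_assoc del: scaleR_minus_left)
  then show ?thesis
    by (simp add: closed_loop_def system_rhs_def linear_feedback_def assms)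
qed

text \<open>The inequality stays strict on the right because the supremum of
  \<open>- (y \<bullet> w)\<close> over the ellipsoid is attained.\<close>

lemma ellipsoid_support_less_iff:
  fixes R :: "real^'n^'n"
  assumes R: "sym_pos_def R"
  shows "(\<forall>w \<in> ellipsoid R. - (y \<bullet> w) < c) \<longleftrightarrow> sqrt (y \<bullet> (matrix_inv R *v y)) < c"
proof -
  \<comment> \<open>With this \<open>z\<close>, the functional \<open>y \<bullet> w\<close> becomes
    the \<open>R\<close>-inner product of \<open>z\<close> and \<open>w\<close>, so Cauchy-Schwarz
    for \<open>R\<close> applies.\<close>
  define z where "z = matrix_inv R *v y"
  define s where "s = y \<bullet> z"
  have Rz: "R *v z = y"
    by (simp add: z_def matrix_vector_mul_assoc matrix_inv_right sym_pos_def_invertible[OF R])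
  have zRz: "z \<bullet> (R *v z) = s"
    by (simp add: Rz s_def inner_commute)
  have s: "0 \<le> s"
    using sym_pos_def_nonneg[OF R, of z] by (simp add: zRz)
  have "sqrt s < c" if *: "\<forall>w \<in> ellipsoid R. - (y \<bullet> w) < c"
  proof -
    \<comment> \<open>The maximiser; for \<open>s = 0\<close> it is \<open>0\<close> by the convention \<open>1 / 0 = 0\<close>.\<close>
    define w where "w = (- (1 / sqrt s)) *\<^sub>R z"
    have "w \<bullet> (R *v w) = s / (sqrt s * sqrt s)"
      by (simp only: w_def matrix_vector_mult_scaleR inner_scaleR_left inner_scaleR_right zRz) simp
    \<comment> \<open>The quotient is 1 if \<open>s > 0\<close>, so \<open>w\<close> lies on the
      boundary, and 0 if \<open>s = 0\<close>.\<close>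
    then have "w \<in> ellipsoid R"
      using s by (simp add: ellipsoid_def)
    then have "- (y \<bullet> w) < c"
      using * by blast
    then show ?thesis
      using s by (simp add: w_def real_div_sqrt flip: s_def)
  qed
  moreover have "- (y \<bullet> w) < c" if "sqrt s < c" "w \<in> ellipsoid R" for w
  proof -
    have "z \<bullet> (R *v w) = y \<bullet> w"
      using R Rz inner_symmetric_matrix[of R z w] by (simp add: sym_pos_def_def)
    then have "(y \<bullet> w)\<^sup>2 \<le> s * (w \<bullet> (R *v w))"
      using sym_pos_def_Cauchy_Schwarz[OF R, of z w] by (simp add: zRz)
    also have "\<dots> \<le> s"
      using that(2) s by (simp add: ellipsoid_def mult_left_le)
    finally have "\<bar>y \<bullet> w\<bar> \<le> sqrt s"
      by (rule real_le_rsqrt[of "\<bar>y \<bullet> w\<bar>", simplified])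
    then show ?thesis
      using that(1) by linarith
  qed
  ultimately show ?thesis
    by (auto simp: s_def z_def)
qed

theorem theorem2:
  fixes B :: "real^'m^'n" and H :: "real^'n^'m"
    and P R\<^sub>w :: "real^'n^'n" and k :: real and x :: "real^'n"
  assumes "\<And>i j. B $ i $ j \<in> \<rat>"
    and "CARD('n) \<le> CARD('m)"
    and "rank B = CARD('n)"
    and "sym_pos_def P"
    and "sym_pos_def R\<^sub>w"
    and "B ** H = mat 1"
    and "0 \<le> k"
  shows "(\<forall>w \<in> ellipsoid R\<^sub>w. deriv_along (quadratic_fun P) x (closed_loop B H k x w) < 0)
    \<longleftrightarrow> k\<^sup>2 * (x \<bullet> (P *v x))\<^sup>2 - x \<bullet> ((P ** matrix_inv R\<^sub>w ** P) *v x) > 0"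
proof -
  define q where "q = x \<bullet> (P *v x)"
  define s where "s = (P *v x) \<bullet> (matrix_inv R\<^sub>w *v (P *v x))"
  have symP: "transpose P = P"
    using assms(4) by (simp add: sym_pos_def_def)
  have s_eq: "x \<bullet> ((P ** matrix_inv R\<^sub>w ** P) *v x) = s"
    by (simp add: s_def inner_symmetric_matrix[OF symP] flip: matrix_vector_mul_assoc)
  \<comment> \<open>The sign of \<open>k\<close> matters: for \<open>k < 0\<close> and
    \<open>x \<noteq> 0\<close> the derivative is positive at \<open>w = 0\<close>, yet the squared
    inequality can hold.\<close>
  have kq: "0 \<le> k * q"
    using assms(7) sym_pos_def_nonneg[OF assms(4), of x] by (simp add: q_def)
  have "deriv_along (quadratic_fun P) x (closed_loop B H k x w) = 2 * (- (k * q) - (P *v x) \<bullet> w)" for w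
    by (simp add: deriv_along_quadratic_fun[OF symP] closed_loop_right_inverse[OF assms(6)]
        inner_diff_right q_def inner_commute[of x])
  then have "(\<forall>w \<in> ellipsoid R\<^sub>w. deriv_along (quadratic_fun P) x (closed_loop B H k x w) < 0)
      \<longleftrightarrow> (\<forall>w \<in> ellipsoid R\<^sub>w. - ((P *v x) \<bullet> w) < k * q)"
    by (intro ball_cong) auto
  \<comment> \<open>Writing \<open>k * q\<close> as the root of its square reduces the comparison to
    the radicands. The case \<open>x = 0\<close> is included: there \<open>s\<close> and
    \<open>q\<close> vanish and both sides are false.\<close>
  also have "\<dots> \<longleftrightarrow> sqrt s < sqrt ((k * q)\<^sup>2)"
    using kq by (simp add: ellipsoid_support_less_iff[OF assms(5)] s_def)
  also have "\<dots> \<longleftrightarrow> k\<^sup>2 * q\<^sup>2 - s > 0"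
    by (simp only: real_sqrt_less_iff power_mult_distrib diff_gt_0_iff_gt)
  finally show ?thesis
    by (simp only: s_eq q_def)
qed

end
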